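(* Let $(A,B)$ be a pair of invertible complex $3\times3$ matrices in general position. Let $(h_1,h_2,h_3)$ be a fixed ordering of the eigenvalues of $A$, let $d_1,d_2,p_\pm,q_\pm,r_\pm,t$ be the coefficients of the spectral curve of $(A,B)$, and let $(L:M:1)$ be the distinguished point of $(A,B)$. Let $\widetilde d_1,\widetilde d_2,\widetilde p_\pm,\widetilde q_\pm,\widetilde r_\pm,\widetilde t$ be the coefficients of the spectral curve of $(A^{-1},B)$, and let $(\widetilde L:\widetilde M:1)$ be the distinguished point of $(A^{-1},B)$ with respect to the ordering $(h_1^{-1},h_2^{-1},h_3^{-1})$ of the eigenvalues of $A^{-1}$. Then the matrix $\begin{pmatrix}-1&0\\0&1\end{pmatrix}\in\mathrm{GL}(2,\mathbb{Z})$, i.e. the operation $(A,B)\mapsto(A^{-1},B)$, corresponds to the following transformation of the space of cubic curves with distinguished points: $$\widetilde d_1=d_1^{-1},\quad \widetilde d_2=d_2,\quad \widetilde p_+=\frac{p_-}{d_1},\quad \widetilde p_-=\frac{p_+}{d_1},\quad \widetilde q_+=q_+,\quad \widetilde q_-=q_-,$$ $$\widetilde r_+=\frac{q_+p_+-t}{d_1},\qquad \widetilde t=\frac{q_+p_--r_+}{d_1},$$ $$\begin{aligned}\widetilde r_-=-\frac1{h_1h_2h_3}\Bigl[&(h_1-h_2)(h_1-h_3)(L+Mh_2)(L+Mh_3)\\&+L\bigl(r_+-th_1+q_+(-h_2h_3+h_1h_3+h_1h_2)\bigr)\\&+M\bigl(r_+(h_2+h_3-h_1)-th_2h_3+q_+h_1h_2h_3\bigr)\\&+q_-h_1(h_2+h_3)-h_1r_-\Bigr],\end{aligned}$$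 $$\widetilde L=L+M(h_2+h_3),\qquad \widetilde M=-h_2h_3M.$$
   Context: Coefficients of the spectral curve. For a pair $(A,B)$ of invertible complex $3\times3$ matrices write $$\det(\lambda+\mu A+\nu B)=\lambda^3+d_1\mu^3+d_2\nu^3+p_+\lambda^2\mu+p_-\lambda\mu^2+q_+\lambda^2\nu+q_-\lambda\nu^2+r_+\mu^2\nu+r_-\mu\nu^2+t\lambda\mu\nu .$$ The spectral curve is the plane cubic $\det(\lambda+\mu A+\nu B)=0$ in $\mathbb{CP}^2$ with coordinates $(\lambda:\mu:\nu)$. Distinguished point. Let the first matrix $A$ of the pair have distinct eigenvalues, listed in a fixed order $h_1,h_2,h_3$. In a basis of eigenvectors of $A$ (in this order) we have $A=\mathrm{diag}(h_1,h_2,h_3)$, and $B$ has a matrix $U=(u_{ij})$, defined up to conjugation by a diagonal matrix. For a pair in general position $u_{12}u_{13}\neq0$. Put $$L=\frac{u_{12}h_3(u_{12}u_{23}-u_{13}u_{22})+u_{13}h_2(u_{12}u_{33}-u_{13}u_{32})}{u_{12}u_{13}(h_3-h_2)},$$ $$M=-\frac{u_{12}(u_{12}u_{23}-u_{13}u_{22})+u_{13}(u_{12}u_{33}-u_{13}u_{32})}{u_{12}u_{13}(h_3-h_2)}.$$ The distinguished point of $(A,B)$ with respect to this ordering is $(L:M:1)$; it lies on the spectral curve. It is the point with $\nu=1$ for which $\ker(\lambda+\mu A+\nu B)$ contains a nonzero vector whose first coordinate in the eigenbasis of $A$ is $0$. The group $\mathrm{GL}(2,\mathbb{Z})\cong\mathrm{Out}(F_2)$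 (outer automorphisms of the free group on $c_1,c_2$) acts on pairs of invertible matrices modulo simultaneous conjugation by substituting $A,B$ for $c_1,c_2$ in the images of the generators; the matrix $\begin{pmatrix}-1&0\\0&1\end{pmatrix}$ is the class of $(c_1,c_2)\mapsto(c_1^{-1},c_2)$.
   Formalization: In the formula for r̃₋ the minus sign before the whole bracket is corrected to apply only to the first summand (h1−h2)(h1−h3)(L+Mh2)(L+Mh3); the printed formula fails for A=diag(1,2,3), B with rows (0,1,1),(1,0,0),(0,0,1), giving 1/3 instead of −1/3. *)

theory Defs
  imports "HOL-Analysis.Analysis"
begin

type_synonym cmat3 = "complex^3^3"

section \<open>Spectral curve\<close>

text \<open>The plane cubics in which the coefficient of the cube of the first variable is 1.\<close>

datatype cubic =
  Cubic (d1: complex) (d2: complex) (p_plus: complex) (p_minus: complex)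
    (q_plus: complex) (q_minus: complex) (r_plus: complex) (r_minus: complex) (t_coeff: complex)

definition cubic_form :: "cubic \<Rightarrow> complex \<Rightarrow> complex \<Rightarrow> complex \<Rightarrow> complex" where
  "cubic_form c l m n =
     l^3 + d1 c * m^3 + d2 c * n^3
     + p_plus c * l^2 * m + p_minus c * l * m^2
     + q_plus c * l^2 * n + q_minus c * l * n^2
     + r_plus c * m^2 * n + r_minus c * m * n^2
     + t_coeff c * l * m * n"

text \<open>A scalar matrix is \<open>mat l\<close>, so the pencil is \<open>mat l + mat m ** A + mat n ** B\<close>.
  Its determinant determines the nine coefficients because \<open>complex\<close> is infinite.\<close>

definition spectral_cubic :: "cmat3 \<Rightarrow> cmat3 \<Rightarrow> cubic" where
  "spectral_cubic A B =
     (THE c. \<forall>l m n. det (mat l + mat m ** A + mat n ** B) = cubic_form c l m n)"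

section \<open>Distinguished point\<close>

definition distinct_eigenvalue_ordering :: "cmat3 \<Rightarrow> complex^3 \<Rightarrow> bool" where
  "distinct_eigenvalue_ordering A h \<longleftrightarrow>
     h$1 \<noteq> h$2 \<and> h$1 \<noteq> h$3 \<and> h$2 \<noteq> h$3 \<and>
     {h$1, h$2, h$3} = {e. \<exists>v. v \<noteq> 0 \<and> A *v v = e *s v}"

text \<open>The columns of \<open>P\<close> are the members of the eigenbasis, in the order given by \<open>h\<close>.\<close>

definition eigenbasis :: "cmat3 \<Rightarrow> complex^3 \<Rightarrow> cmat3 \<Rightarrow> bool" where
  "eigenbasis A h P \<longleftrightarrow>
     invertible P \<and> (\<forall>i. A *v column i P = (h$i) *s column i P)"

definition in_basis :: "cmat3 \<Rightarrow> cmat3 \<Rightarrow> cmat3" where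
  "in_basis P B = matrix_inv P ** B ** P"

definition L_coord :: "complex^3 \<Rightarrow> cmat3 \<Rightarrow> complex" where
  "L_coord h U =
     (U$1$2 * h$3 * (U$1$2 * U$2$3 - U$1$3 * U$2$2)
      + U$1$3 * h$2 * (U$1$2 * U$3$3 - U$1$3 * U$3$2))
     / (U$1$2 * U$1$3 * (h$3 - h$2))"

definition M_coord :: "complex^3 \<Rightarrow> cmat3 \<Rightarrow> complex" where
  "M_coord h U =
     - (U$1$2 * (U$1$2 * U$2$3 - U$1$3 * U$2$2)
        + U$1$3 * (U$1$2 * U$3$3 - U$1$3 * U$3$2))
     / (U$1$2 * U$1$3 * (h$3 - h$2))"

text \<open>The eigenbasis is unique up to rescaling its members, under which \<open>L_coord\<close> and
  \<open>M_coord\<close> are invariant; \<open>(L, M)\<close> stands for the point \<open>(L : M : 1)\<close>.\<close>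

definition distinguished_point :: "cmat3 \<Rightarrow> cmat3 \<Rightarrow> complex^3 \<Rightarrow> complex \<times> complex" where
  "distinguished_point A B h =
     (THE x. \<exists>P. eigenbasis A h P \<and>
        x = (L_coord h (in_basis P B), M_coord h (in_basis P B)))"

text \<open>General position means exactly what makes the distinguished point well defined;
  the entries \<open>U$1$2\<close> and \<open>U$1$3\<close> vanish in every eigenbasis or in none.\<close>

definition general_position :: "cmat3 \<Rightarrow> cmat3 \<Rightarrow> complex^3 \<Rightarrow> bool" where
  "general_position A B h \<longleftrightarrow>
     distinct_eigenvalue_ordering A h \<and>
     (\<forall>P. eigenbasis A h P \<longrightarrow> in_basis P B $ 1 $ 2 \<noteq> 0 \<and> in_basis P B $ 1 $ 3 \<noteq> 0)"

section \<open>The action of integer matrices through outer automorphisms\<close>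

text \<open>An element of the free group on \<open>C1, C2\<close> is given by a word in signed letters up to
  free equality; \<open>(c, True)\<close> stands for the generator and \<open>(c, False)\<close> for its inverse.
  An endomorphism is given by the words for the images of the generators.\<close>

datatype gen = C1 | C2

type_synonym fword = "(gen \<times> bool) list"

inductive free_eq :: "fword \<Rightarrow> fword \<Rightarrow> bool" where
  refl: "free_eq w w"
| sym: "free_eq v w \<Longrightarrow> free_eq w v"
| trans: "free_eq u v \<Longrightarrow> free_eq v w \<Longrightarrow> free_eq u w"
| cancel: "free_eq (u @ [(c, s), (c, \<not> s)] @ v) (u @ v)"

definition inv_word :: "fword \<Rightarrow> fword" where
  "inv_word w = rev (map (\<lambda>(c, s). (c, \<not> s)) w)"

definition subst_word :: "(gen \<Rightarrow> fword) \<Rightarrow> fword \<Rightarrow> fword" where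
  "subst_word \<phi> w = concat (map (\<lambda>(c, s). if s then \<phi> c else inv_word (\<phi> c)) w)"

definition free_automorphism :: "(gen \<Rightarrow> fword) \<Rightarrow> bool" where
  "free_automorphism \<phi> \<longleftrightarrow>
     (\<exists>\<psi>. \<forall>c. free_eq (subst_word \<phi> (\<psi> c)) [(c, True)] \<and>
              free_eq (subst_word \<psi> (\<phi> c)) [(c, True)])"

definition exponent_sum :: "gen \<Rightarrow> fword \<Rightarrow> int" where
  "exponent_sum c w = (\<Sum>(c', s)\<leftarrow>w. if c' = c then (if s then 1 else -1) else 0)"

text \<open>The induced map on the abelianization; column \<open>j\<close> is the image of generator \<open>j\<close>.\<close>

definition abelianization :: "(gen \<Rightarrow> fword) \<Rightarrow> int^2^2" where
  "abelianization \<phi> =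
     vector [vector [exponent_sum C1 (\<phi> C1), exponent_sum C1 (\<phi> C2)],
             vector [exponent_sum C2 (\<phi> C1), exponent_sum C2 (\<phi> C2)]]"

fun word_value :: "cmat3 \<Rightarrow> cmat3 \<Rightarrow> fword \<Rightarrow> cmat3" where
  "word_value A B [] = mat 1"
| "word_value A B ((c, s) # w) =
     (let X = (case c of C1 \<Rightarrow> A | C2 \<Rightarrow> B)
      in (if s then X else matrix_inv X) ** word_value A B w)"

definition simultaneously_conjugate :: "cmat3 \<times> cmat3 \<Rightarrow> cmat3 \<times> cmat3 \<Rightarrow> bool" where
  "simultaneously_conjugate X Y \<longleftrightarrow>
     (\<exists>P. invertible P \<and> fst Y = P ** fst X ** matrix_inv P
                       \<and> snd Y = P ** snd X ** matrix_inv P)"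

text \<open>\<open>GL2Z_action G X Y\<close>: the class of \<open>G\<close> in the outer automorphism group sends the
  conjugacy class of the pair \<open>X\<close> to that of \<open>Y\<close>. By Nielsen's theorem, automorphisms with
  the same abelianization differ by an inner one, so \<open>Y\<close> is unique up to conjugation.\<close>

definition GL2Z_action :: "int^2^2 \<Rightarrow> cmat3 \<times> cmat3 \<Rightarrow> cmat3 \<times> cmat3 \<Rightarrow> bool" where
  "GL2Z_action G X Y \<longleftrightarrow>
     (\<exists>\<phi>. free_automorphism \<phi> \<and> abelianization \<phi> = G \<and>
        simultaneously_conjugate
          (word_value (fst X) (snd X) (\<phi> C1), word_value (fst X) (snd X) (\<phi> C2)) Y)"

section \<open>Sign of the formula for the new \<open>r_minus\<close>\<close>

text \<open>In the published formula for the new coefficient \<open>r_minus\<close>, a minus sign stands in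
  front of the whole bracket. With the conventions above it belongs to the first summand
  \<open>(h1 - h2) (h1 - h3) (L + M h2) (L + M h3)\<close> only. For example, take
  \<open>A = diag(1, 2, 3)\<close> and \<open>B\<close> with rows \<open>(0, 1, 1)\<close>, \<open>(1, 0, 0)\<close>, \<open>(0, 0, 1)\<close>, so that
  \<open>L = 2\<close>, \<open>M = -1\<close> and this summand is 0: the new coefficient is \<open>-1/3\<close>, while the
  published formula gives \<open>1/3\<close>.\<close>

end

theory Submission
  imports Defs
begin

text \<open>An eigenbasis of \<open>A\<close> is one of \<open>A\<inverse>\<close> too, so both spectral curves are read off from
  \<open>diag(h)\<close>, its inverse and the same matrix \<open>U\<close> of \<open>B\<close>; only the new \<open>r_minus\<close> involves
  off-diagonal entries of \<open>U\<close> in a combination that the old coefficients do not determine.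
  The distinguished point supplies the missing product \<open>u\<^sub>2\<^sub>3 u\<^sub>3\<^sub>2\<close>, since
  \<open>L + M h\<^sub>2 = u\<^sub>1\<^sub>2 u\<^sub>2\<^sub>3 / u\<^sub>1\<^sub>3 - u\<^sub>2\<^sub>2\<close> and \<open>L + M h\<^sub>3 = u\<^sub>1\<^sub>3 u\<^sub>3\<^sub>2 / u\<^sub>1\<^sub>2 - u\<^sub>3\<^sub>3\<close>.
  The same two combinations give the transformation of \<open>L\<close> and \<open>M\<close>.\<close>

section \<open>Uniqueness of the coefficients of a cubic form\<close>

lemma cubic_form_inject:
  assumes "\<And>l m n. cubic_form c l m n = cubic_form c' l m n"
  shows "c = c'"
proof (cases c; cases c')
  fix a1 a2 a3 a4 a5 a6 a7 a8 a9 b1 b2 b3 b4 b5 b6 b7 b8 b9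
  assume c: "c = Cubic a1 a2 a3 a4 a5 a6 a7 a8 a9" "c' = Cubic b1 b2 b3 b4 b5 b6 b7 b8 b9"
  note ev = assms[unfolded c cubic_form_def cubic.sel]
  have e: "a1 = b1" "a2 = b2"
    using ev[of 0 1 0] ev[of 0 0 1] by simp_all
  \<comment> \<open>On each coordinate line the two mixed coefficients are separated by their sum
    and difference, read off at opposite signs. With \<open>(1, 1, 1)\<close> for the last
    coefficient, nine points suffice.\<close>
  have "a3 + a4 = b3 + b4" "a4 - a3 = b4 - b3" "a5 + a6 = b5 + b6" "a6 - a5 = b6 - b5"
    "a7 + a8 = b7 + b8" "a8 - a7 = b8 - b7"
    using ev[of 1 1 0] ev[of 1 "-1" 0] ev[of 1 0 1] ev[of 1 0 "-1"] ev[of 0 1 1] ev[of 0 1 "-1"] e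
    by (simp_all add: algebra_simps)
  then have f: "a3 = b3" "a4 = b4" "a5 = b5" "a6 = b6" "a7 = b7" "a8 = b8"
    by algebra+
  have "a9 = b9"
    using ev[of 1 1 1] e f by simp
  with c e f show ?thesis by simp
qed

lemma spectral_cubic_eqI:
  assumes "\<And>l m n. det (mat l + mat m ** A + mat n ** B) = cubic_form c l m n"
  shows "spectral_cubic A B = c"
  unfolding spectral_cubic_def
proof (rule the_equality)
  fix c'
  assume "\<forall>l m n. det (mat l + mat m ** A + mat n ** B) = cubic_form c' l m n"
  then show "c' = c"
    using assms by (intro cubic_form_inject) metis
qed (use assms in blast)

section \<open>Matrix inverses and change of basis\<close>

lemma
  fixes X :: "'a::semiring_1^'n^'m"
  assumes "invertible X"
  shows matrix_inv_left: "matrix_inv X ** X = mat 1"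
    and matrix_inv_right: "X ** matrix_inv X = mat 1"
proof -
  have "X ** matrix_inv X = mat 1 \<and> matrix_inv X ** X = mat 1"
    unfolding matrix_inv_def by (rule someI_ex) (use assms in \<open>simp add: invertible_def\<close>)
  then show "matrix_inv X ** X = mat 1" "X ** matrix_inv X = mat 1" by simp_all
qed

lemma invertible_matrix_inv: "invertible X \<Longrightarrow> invertible (matrix_inv X)"
  unfolding invertible_def[of "matrix_inv X"] using matrix_inv_left matrix_inv_right by blast

lemma matrix_add_rdistrib: "(X + Y) ** Z = X ** Z + Y ** Z"
  by (vector matrix_matrix_mult_def sum.distrib[symmetric] distrib_right)

lemma mat_mult_commute: "mat (c::complex) ** X = X ** mat c"
  by (vector matrix_matrix_mult_def mat_def) (simp add: if_distrib if_distribR cong: if_cong)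

lemma in_basis_pencil:
  assumes "invertible P"
  shows "in_basis P (mat l + mat m ** A + mat n ** B)
    = mat l + mat m ** in_basis P A + mat n ** in_basis P B"
proof -
  have s: "matrix_inv P ** (mat c ** X) ** P = mat c ** (matrix_inv P ** X ** P)" for c X
    by (metis mat_mult_commute matrix_mul_assoc)
  have "matrix_inv P ** mat l ** P = mat l"
    using assms by (metis mat_mult_commute matrix_inv_left matrix_mul_assoc matrix_mul_rid)
  then show ?thesis
    by (simp add: in_basis_def matrix_add_ldistrib matrix_add_rdistrib s)
qed

lemma det_in_basis:
  assumes "invertible P"
  shows "det (in_basis P X) = det X"
proof -
  have "det (matrix_inv P) * det P = 1"
    using assms by (metis det_I det_mul matrix_inv_left)
  then show ?thesis
    by (simp add: in_basis_def det_mul algebra_simps)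
qed

section \<open>Spectral curve of a pair whose first member is diagonal\<close>

definition diag_mat :: "complex^3 \<Rightarrow> cmat3" where
  "diag_mat h = (\<chi> i j. if i = j then h$i else 0)"

lemma matrix_mult_diag_mat [simp]: "(X ** diag_mat h) $ i $ j = X$i$j * h$j"
  by (simp add: matrix_matrix_mult_def diag_mat_def if_distrib if_distribR cong: if_cong)

lemma diag_mat_mult [simp]: "(diag_mat h ** X) $ i $ j = h$i * X$i$j"
  by (simp add: matrix_matrix_mult_def diag_mat_def if_distrib if_distribR cong: if_cong)

lemma mat_mult_nth: "(mat c ** X) $ i $ j = c * X$i$j" for c :: complex
  by (simp add: matrix_matrix_mult_def mat_def if_distrib if_distribR cong: if_cong)

text \<open>Expanding the determinant along the diagonal part leaves only principal minors of
  \<open>U\<close>, weighted by products of the \<open>h$i\<close>. Off-diagonal entries thus occur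
  only in \<open>d2\<close>, \<open>q_minus\<close> and \<open>r_minus\<close>.\<close>

lemma spectral_cubic_diag:
  "spectral_cubic (diag_mat h) U = Cubic (h$1 * h$2 * h$3) (det U)
     (h$1 + h$2 + h$3) (h$1 * h$2 + h$1 * h$3 + h$2 * h$3)
     (U$1$1 + U$2$2 + U$3$3)
     (U$1$1 * U$2$2 - U$1$2 * U$2$1 + (U$1$1 * U$3$3 - U$1$3 * U$3$1)
       + (U$2$2 * U$3$3 - U$2$3 * U$3$2))
     (h$1 * h$2 * U$3$3 + h$1 * h$3 * U$2$2 + h$2 * h$3 * U$1$1)
     (h$1 * (U$2$2 * U$3$3 - U$2$3 * U$3$2) + h$2 * (U$1$1 * U$3$3 - U$1$3 * U$3$1)
       + h$3 * (U$1$1 * U$2$2 - U$1$2 * U$2$1))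
     (h$1 * (U$2$2 + U$3$3) + h$2 * (U$1$1 + U$3$3) + h$3 * (U$1$1 + U$2$2))"
  by (rule spectral_cubic_eqI)
    (simp add: det_3 mat_mult_nth cubic_form_def, simp add: diag_mat_def mat_def, algebra)

lemma spectral_cubic_in_basis:
  assumes "invertible P"
  shows "spectral_cubic (in_basis P A) (in_basis P B) = spectral_cubic A B"
proof -
  have "det (mat l + mat m ** in_basis P A + mat n ** in_basis P B)
      = det (mat l + mat m ** A + mat n ** B)" for l m n
    using assms by (metis det_in_basis in_basis_pencil)
  then show ?thesis
    by (simp add: spectral_cubic_def)
qed

section \<open>Eigenbases: existence and uniqueness up to rescaling\<close>

lemma eigenbasis_iff: "eigenbasis A h P \<longleftrightarrow> invertible P \<and> A ** P = P ** diag_mat h"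
  by (auto simp: eigenbasis_def vec_eq_iff column_def matrix_vector_mult_def
      matrix_matrix_mult_def diag_mat_def if_distrib if_distribR mult.commute cong: if_cong)

lemma in_basis_eigenbasis:
  assumes "eigenbasis A h P"
  shows "in_basis P A = diag_mat h"
  using assms unfolding eigenbasis_iff in_basis_def
  by (metis matrix_inv_left matrix_mul_assoc matrix_mul_lid)

lemma spectral_cubic_eigenbasis:
  assumes "eigenbasis A h P"
  shows "spectral_cubic A B = spectral_cubic (diag_mat h) (in_basis P B)"
  using assms in_basis_eigenbasis spectral_cubic_in_basis
  by (metis eigenbasis_def)

text \<open>Eigenvectors for distinct eigenvalues are independent, so placing one for each
  \<open>h$i\<close> as a column gives an invertible matrix.\<close>

lemma eigenbasis_exists:
  assumes "distinct_eigenvalue_ordering A h"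
  obtains P where "eigenbasis A h P"
proof -
  have ne: "h$1 \<noteq> h$2" "h$1 \<noteq> h$3" "h$2 \<noteq> h$3"
    using assms by (auto simp: distinct_eigenvalue_ordering_def)
  have "\<exists>v. v \<noteq> 0 \<and> A *v v = (h$i) *s v" for i
  proof -
    have "h$i \<in> {h$1, h$2, h$3}"
      by (metis exhaust_3 insertCI)
    also have "\<dots> = {e. \<exists>v. v \<noteq> 0 \<and> A *v v = e *s v}"
      using assms unfolding distinct_eigenvalue_ordering_def by metis
    finally show ?thesis by simp
  qed
  then obtain v where v: "\<And>i. v i \<noteq> 0" "\<And>i. A *v v i = (h$i) *s v i"
    by metis
  define P :: cmat3 where "P = (\<chi> k i. v i $ k)"
  have col: "column i P = v i" for i
    by (simp add: P_def column_def vec_eq_iff)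
  have AP: "A ** P = P ** diag_mat h"
    using v(2) by (simp add: vec_eq_iff P_def matrix_matrix_mult_def matrix_vector_mult_def
        diag_mat_def if_distrib if_distribR mult.commute cong: if_cong)
  have "x = 0" if x: "P *v x = 0" for x
  proof -
    \<comment> \<open>The kernel of \<open>P\<close> is stable under \<open>diag_mat h\<close>, so
      one linear relation among the eigenvectors yields two more, with coefficients multiplied by
      \<open>h$i\<close> and by its square.\<close>
    have "P *v (diag_mat h *v y) = A *v (P *v y)" for y
      by (simp add: matrix_vector_mul_assoc AP)
    then have x': "P *v (diag_mat h *v x) = 0" "P *v (diag_mat h *v (diag_mat h *v x)) = 0"
      using x by simp_all
    have d: "(diag_mat h *v y) $ i = h$i * y$i" for y i
      by (simp add: matrix_vector_mult_def diag_mat_def if_distrib if_distribR cong: if_cong)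
    have s: "P *v y = 0 \<Longrightarrow> v 1 $ k * y$1 + v 2 $ k * y$2 + v 3 $ k * y$3 = 0" for y k
      by (simp add: vec_eq_iff matrix_vector_mult_def P_def sum_3)
    have "v 1 $ k * x$1 = 0 \<and> v 2 $ k * x$2 = 0 \<and> v 3 $ k * x$3 = 0" for k
    proof -
      note e = s[OF x, of k] s[OF x'(1), of k, unfolded d] s[OF x'(2), of k, unfolded d]
      \<comment> \<open>Lagrange interpolation: the three relations are combined by the quadratic
        polynomial that vanishes at the other two eigenvalues.\<close>
      have "(h$1 - h$2) * (h$1 - h$3) * (v 1 $ k * x$1) = 0"
        "(h$2 - h$1) * (h$2 - h$3) * (v 2 $ k * x$2) = 0"
        "(h$3 - h$1) * (h$3 - h$2) * (v 3 $ k * x$3) = 0"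
        using e by algebra+
      then show ?thesis using ne by auto
    qed
    then have "x$1 = 0" "x$2 = 0" "x$3 = 0"
      using v(1)[of 1] v(1)[of 2] v(1)[of 3] by (auto simp: vec_eq_iff)
    then show ?thesis by (simp add: vec_eq_iff forall_3)
  qed
  then have "invertible P"
    by (metis invertible_left_inverse matrix_left_invertible_ker)
  with AP have "eigenbasis A h P" by (simp add: eigenbasis_iff)
  then show ?thesis using that by blast
qed

text \<open>Two eigenbases differ by a matrix commuting with \<open>diag_mat h\<close>, hence by a diagonal one.\<close>

lemma in_basis_eigenbasis_rescale:
  assumes P: "eigenbasis A h P" and Q: "eigenbasis A h Q"
    and ne: "h$1 \<noteq> h$2" "h$1 \<noteq> h$3" "h$2 \<noteq> h$3"
  shows "\<exists>c. (\<forall>i. c i \<noteq> 0) \<and> (\<forall>i j. c i * in_basis Q B $ i $ j = in_basis P B $ i $ j * c j)"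
proof -
  note inv = P[unfolded eigenbasis_iff, THEN conjunct1] Q[unfolded eigenbasis_iff, THEN conjunct1]
  define C where "C = matrix_inv P ** Q"
  have QC: "Q = P ** C"
    by (simp add: C_def matrix_mul_assoc inv matrix_inv_right)
  have invC: "invertible C"
    unfolding C_def using inv by (simp add: invertible_mult invertible_matrix_inv)
  have "P ** (diag_mat h ** C) = P ** (C ** diag_mat h)"
    using P Q unfolding eigenbasis_iff QC by (metis matrix_mul_assoc)
  then have comm: "diag_mat h ** C = C ** diag_mat h"
    using inv(1) by (metis matrix_inv_left matrix_mul_assoc matrix_mul_lid)
  have off: "C$i$j = 0" if "i \<noteq> j" for i j
  proof -
    have "h$i * C$i$j = C$i$j * h$j"
      using comm by (metis diag_mat_mult matrix_mult_diag_mat)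
    moreover have "h$i \<noteq> h$j"
      using that ne by (metis exhaust_3)
    ultimately show ?thesis by simp
  qed
  define c where "c = (\<chi> i. C$i$i)"
  have Cd: "C = diag_mat c"
    using off by (simp add: vec_eq_iff diag_mat_def c_def)
  have "det C = c$1 * c$2 * c$3"
    by (simp add: Cd det_3 diag_mat_def)
  then have "c$1 \<noteq> 0" "c$2 \<noteq> 0" "c$3 \<noteq> 0"
    using invC invertible_det_nz[of C] by auto
  then have nz: "c$i \<noteq> 0" for i
    using exhaust_3[of i] by auto
  have "C ** in_basis Q B = matrix_inv P ** B ** Q"
    unfolding in_basis_def C_def
    by (metis inv(2) matrix_inv_right matrix_mul_assoc matrix_mul_rid)
  also have "\<dots> = in_basis P B ** C"
    by (simp add: in_basis_def QC matrix_mul_assoc)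
  finally have "c$i * in_basis Q B $ i $ j = in_basis P B $ i $ j * c$j" for i j
    unfolding Cd by (metis diag_mat_mult matrix_mult_diag_mat)
  with nz show ?thesis by blast
qed

section \<open>Independence of the distinguished point from the choice of eigenbasis\<close>

lemma LM_coord_rescale:
  assumes nz: "\<And>i. c i \<noteq> 0" and V: "\<And>i j. c i * V$i$j = U$i$j * c j"
  shows "L_coord h V = L_coord h U" "M_coord h V = M_coord h U"
proof -
  have V': "V$i$j = U$i$j * c j / c i" for i j
    using nz[of i] V[of i j] by (simp add: field_simps)
  \<comment> \<open>This is the common factor by which numerator and denominator of both coordinates
    scale, so it cancels.\<close>
  define s where "s = c 2 * c 3 / (c 1)^2"
  have s: "s \<noteq> 0" using nz by (simp add: s_def)
  have *: "V$1$2 * V$2$3 - V$1$3 * V$2$2 = (c 3 / c 1) * (U$1$2 * U$2$3 - U$1$3 * U$2$2)"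
    "V$1$2 * V$3$3 - V$1$3 * V$3$2 = (c 2 / c 1) * (U$1$2 * U$3$3 - U$1$3 * U$3$2)"
    "V$1$2 * V$1$3 = s * (U$1$2 * U$1$3)"
    using nz[of 1] nz[of 2] nz[of 3] unfolding V' s_def
    by (simp_all add: field_simps power2_eq_square)
  have n: "V$1$2 * x * ((c 3 / c 1) * y) = s * (U$1$2 * x * y)"
    "V$1$3 * x * ((c 2 / c 1) * y) = s * (U$1$3 * x * y)"
    "V$1$2 * ((c 3 / c 1) * y) = s * (U$1$2 * y)"
    "V$1$3 * ((c 2 / c 1) * y) = s * (U$1$3 * y)" for x y
    unfolding V' s_def by (simp_all add: power2_eq_square)
  show "L_coord h V = L_coord h U" "M_coord h V = M_coord h U"
    unfolding L_coord_def M_coord_def * n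
    unfolding mult.assoc distrib_left[symmetric] mult_minus_right[symmetric]
    using s by simp_all
qed

lemma distinguished_point_eigenbasis:
  assumes "eigenbasis A h P" and "h$1 \<noteq> h$2" "h$1 \<noteq> h$3" "h$2 \<noteq> h$3"
  shows "distinguished_point A B h = (L_coord h (in_basis P B), M_coord h (in_basis P B))"
  unfolding distinguished_point_def
proof (rule the_equality)
  fix x
  assume "\<exists>Q. eigenbasis A h Q \<and> x = (L_coord h (in_basis Q B), M_coord h (in_basis Q B))"
  then obtain Q where Q: "eigenbasis A h Q"
    "x = (L_coord h (in_basis Q B), M_coord h (in_basis Q B))"
    by blast
  obtain c where "\<And>i. c i \<noteq> 0" "\<And>i j. c i * in_basis Q B $ i $ j = in_basis P B $ i $ j * c j"
    using in_basis_eigenbasis_rescale[OF assms(1) Q(1) assms(2-4), of B] by blast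
  then show "x = (L_coord h (in_basis P B), M_coord h (in_basis P B))"
    unfolding Q(2) using LM_coord_rescale by metis
qed (use assms in blast)

section \<open>Passage from \<open>A\<close> to its inverse\<close>

lemma eigenbasis_matrix_inv:
  assumes "invertible A" and P: "eigenbasis A h P"
  shows "h$i \<noteq> 0" and "eigenbasis (matrix_inv A) (\<chi> i. inverse (h$i)) P"
proof -
  have iP: "invertible P" using P by (simp add: eigenbasis_def)
  \<comment> \<open>The product of the eigenvalues is \<open>det A\<close>, so invertibility of
    \<open>A\<close> forces each of them to be nonzero.\<close>
  have "det (diag_mat h) = det A"
    by (metis P det_in_basis iP in_basis_eigenbasis)
  then have "h$1 * h$2 * h$3 \<noteq> 0"
    using assms(1) by (simp add: invertible_det_nz det_3 diag_mat_def)
  then have nz: "h$i \<noteq> 0" for i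
    using exhaust_3[of i] by auto
  show "h$i \<noteq> 0" by (rule nz)
  let ?k = "\<chi> i. inverse (h$i)"
  have "diag_mat h ** diag_mat ?k = mat 1"
    using nz by (simp add: vec_eq_iff mat_def) (simp add: diag_mat_def)
  then have "matrix_inv A ** P = matrix_inv A ** (P ** diag_mat h) ** diag_mat ?k"
    by (metis matrix_mul_assoc matrix_mul_rid)
  also have "\<dots> = P ** diag_mat ?k"
    using P assms(1) unfolding eigenbasis_iff
    by (metis matrix_inv_left matrix_mul_assoc matrix_mul_lid)
  finally show "eigenbasis (matrix_inv A) ?k P"
    using iP by (simp add: eigenbasis_iff)
qed

lemma GL2Z_action_inverse_first:
  "GL2Z_action (vector [vector [-1, 0], vector [0, 1]]) (A, B) (matrix_inv A, B)"
proof -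
  define \<phi> :: "gen \<Rightarrow> fword" where
    "\<phi> = (\<lambda>c. case c of C1 \<Rightarrow> [(C1, False)] | C2 \<Rightarrow> [(C2, True)])"
  \<comment> \<open>\<open>\<phi>\<close> is an involution and therefore serves as its own inverse
    automorphism.\<close>
  have "free_eq (subst_word \<phi> (\<phi> c)) [(c, True)]" for c
    by (cases c) (simp_all add: \<phi>_def subst_word_def inv_word_def free_eq.refl)
  then have "free_automorphism \<phi>"
    unfolding free_automorphism_def by blast
  moreover have "abelianization \<phi> = vector [vector [-1, 0], vector [0, 1]]"
    by (simp add: abelianization_def exponent_sum_def \<phi>_def)
  moreover have inv1: "invertible (mat 1 :: cmat3)"
    by (simp add: invertible_det_nz)
  moreover have "matrix_inv (mat 1 :: cmat3) = mat 1"
    using matrix_inv_left[of "mat 1 :: cmat3"] inv1 by simp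
  then have "simultaneously_conjugate (word_value A B (\<phi> C1), word_value A B (\<phi> C2))
      (matrix_inv A, B)"
    unfolding simultaneously_conjugate_def
    by (intro exI[of _ "mat 1"]) (simp add: \<phi>_def inv1)
  ultimately show ?thesis
    unfolding GL2Z_action_def by auto
qed

text \<open>A kernel vector with first coordinate 0 is proportional to
  \<open>(0, U$1$3, - U$1$2)\<close> by the first row of the pencil; the second and third rows
  applied to it are these two equations.\<close>

lemma LM_coord_combinations:
  assumes "U$1$2 \<noteq> 0" "U$1$3 \<noteq> 0" "h$2 \<noteq> h$3"
  shows "L_coord h U + M_coord h U * h$2 = U$1$2 * U$2$3 / U$1$3 - U$2$2"
    and "L_coord h U + M_coord h U * h$3 = U$1$3 * U$3$2 / U$1$2 - U$3$3"
proof -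
  have "h$3 - h$2 \<noteq> 0" using assms by simp
  then show "L_coord h U + M_coord h U * h$2 = U$1$2 * U$2$3 / U$1$3 - U$2$2"
    "L_coord h U + M_coord h U * h$3 = U$1$3 * U$3$2 / U$1$2 - U$3$3"
    using assms unfolding L_coord_def M_coord_def
    by (simp_all add: divide_simps, algebra+)
qed

text \<open>The right-hand sides in \<open>LM_coord_combinations\<close> do not involve the
  eigenvalues, so they agree for \<open>h\<close> and its inverses. This leaves two linear equations
  for the new coordinates.\<close>

lemma LM_coord_inverse:
  assumes "U$1$2 \<noteq> 0" "U$1$3 \<noteq> 0" "h$2 \<noteq> h$3" "h$2 \<noteq> 0" "h$3 \<noteq> 0"
  shows "L_coord (\<chi> i. inverse (h$i)) U = L_coord h U + M_coord h U * (h$2 + h$3)"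
    and "M_coord (\<chi> i. inverse (h$i)) U = - h$2 * h$3 * M_coord h U"
proof -
  let ?k = "\<chi> i. inverse (h$i)" and ?L = "L_coord h U" and ?M = "M_coord h U"
  let ?L' = "L_coord ?k U" and ?M' = "M_coord ?k U"
  have "?L' + ?M' * inverse (h$2) = ?L + ?M * h$2" "?L' + ?M' * inverse (h$3) = ?L + ?M * h$3"
    using LM_coord_combinations[OF assms(1-3)] LM_coord_combinations[of U ?k] assms
    by simp_all
  then have e: "?L' * h$2 + ?M' = h$2 * (?L + ?M * h$2)" "?L' * h$3 + ?M' = h$3 * (?L + ?M * h$3)"
    using assms by (simp_all add: field_simps)
  then have "(h$2 - h$3) * ?L' = (h$2 - h$3) * (?L + ?M * (h$2 + h$3))"
    by algebra
  then show L: "?L' = ?L + ?M * (h$2 + h$3)"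
    using assms by simp
  show "?M' = - h$2 * h$3 * ?M"
    using e(1) unfolding L by algebra
qed

theorem proposition3p2:
  fixes A B :: "complex^3^3"
    and h1 h2 h3 d1 d2 pp pm qp qm rp rm t L M :: complex
    and d1' d2' pp' pm' qp' qm' rp' rm' t' L' M' :: complex
  assumes "invertible A" and "invertible B"
    and "general_position A B (vector [h1, h2, h3])"
    and "spectral_cubic A B = Cubic d1 d2 pp pm qp qm rp rm t"
    and "distinguished_point A B (vector [h1, h2, h3]) = (L, M)"
    and "spectral_cubic (matrix_inv A) B = Cubic d1' d2' pp' pm' qp' qm' rp' rm' t'"
    and "distinguished_point (matrix_inv A) B (vector [inverse h1, inverse h2, inverse h3])
           = (L', M')"
  shows "GL2Z_action (vector [vector [-1, 0], vector [0, 1]]) (A, B) (matrix_inv A, B)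
    \<and> d1' = inverse d1 \<and> d2' = d2
    \<and> pp' = pm / d1 \<and> pm' = pp / d1
    \<and> qp' = qp \<and> qm' = qm
    \<and> rp' = (qp * pp - t) / d1
    \<and> t' = (qp * pm - rp) / d1
    \<and> rm' = 1 / (h1 * h2 * h3) *
        (- ((h1 - h2) * (h1 - h3) * (L + M * h2) * (L + M * h3))
         + L * (rp - t * h1 + qp * (- h2 * h3 + h1 * h3 + h1 * h2))
         + M * (rp * (h2 + h3 - h1) - t * h2 * h3 + qp * h1 * h2 * h3)
         + qm * h1 * (h2 + h3) - h1 * rm)
    \<and> L' = L + M * (h2 + h3)
    \<and> M' = - h2 * h3 * M"
proof -
  define h :: "complex^3" where "h = vector [h1, h2, h3]"
  define k :: "complex^3" where "k = (\<chi> i. inverse (h$i))"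
  have h: "h$1 = h1" "h$2 = h2" "h$3 = h3"
    by (simp_all add: h_def)
  have k: "k$1 = inverse h1" "k$2 = inverse h2" "k$3 = inverse h3"
    by (simp_all add: k_def h)
  have kv: "vector [inverse h1, inverse h2, inverse h3] = k"
    by (simp add: vec_eq_iff forall_3 k)
  note gp = assms(3)[folded h_def, unfolded general_position_def]
  have ne: "h1 \<noteq> h2" "h1 \<noteq> h3" "h2 \<noteq> h3"
    using gp by (auto simp: distinct_eigenvalue_ordering_def h)
  obtain P where P: "eigenbasis A h P"
    using eigenbasis_exists gp by blast
  define U where "U = in_basis P B"
  have U: "U$1$2 \<noteq> 0" "U$1$3 \<noteq> 0"
    using gp P by (auto simp: U_def)
  have nz: "h1 \<noteq> 0" "h2 \<noteq> 0" "h3 \<noteq> 0"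
    using eigenbasis_matrix_inv(1)[OF assms(1) P] h by metis+
  have P': "eigenbasis (matrix_inv A) k P"
    unfolding k_def by (rule eigenbasis_matrix_inv(2)[OF assms(1) P])
  have LM: "L = L_coord h U" "M = M_coord h U"
    using distinguished_point_eigenbasis[OF P, of B] assms(5) ne
    by (simp_all add: h U_def flip: h_def)
  have "L' = L_coord k U" "M' = M_coord k U"
    using distinguished_point_eigenbasis[OF P', of B] assms(7) ne
    by (simp_all add: k kv U_def)
  then have LM': "L' = L + M * (h2 + h3)" "M' = - h2 * h3 * M"
    using LM_coord_inverse[of U h] U ne nz by (simp_all add: LM k_def h)
  note c = assms(4)[symmetric, unfolded spectral_cubic_eigenbasis[OF P] spectral_cubic_diag h cubic.inject,
      folded U_def]
  note c' = assms(6)[symmetric, unfolded spectral_cubic_eigenbasis[OF P'] spectral_cubic_diag k cubic.inject,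
      folded U_def]
  \<comment> \<open>The factors \<open>U$1$2\<close> and \<open>U$1$3\<close> cancel in the product
    of \<open>w\<close> and \<open>z\<close>, which is how \<open>U$2$3 * U$3$2\<close> is recovered
    from \<open>L\<close> and \<open>M\<close>.\<close>
  define w where "w = U$1$2 * U$2$3 / U$1$3"
  define z where "z = U$1$3 * U$3$2 / U$1$2"
  have wz: "w * z = U$2$3 * U$3$2"
    using U by (simp add: w_def z_def)
  have comb: "L + M * h2 = w - U$2$2" "L + M * h3 = z - U$3$3"
    using LM_coord_combinations[of U h] U ne by (simp_all add: LM h w_def z_def)
  have "h1 * h2 * h3 * rm' = h2 * h3 * (U$2$2 * U$3$3 - U$2$3 * U$3$2)
      + h1 * h3 * (U$1$1 * U$3$3 - U$1$3 * U$3$1) + h1 * h2 * (U$1$1 * U$2$2 - U$1$2 * U$2$1)"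
    using nz by (simp add: c' field_simps)
  also have "\<dots> = - ((h1 - h2) * (h1 - h3) * (L + M * h2) * (L + M * h3))
         + L * (rp - t * h1 + qp * (- h2 * h3 + h1 * h3 + h1 * h2))
         + M * (rp * (h2 + h3 - h1) - t * h2 * h3 + qp * h1 * h2 * h3)
         + qm * h1 * (h2 + h3) - h1 * rm" (is "_ = ?R")
  proof -
    \<comment> \<open>Only diagonal entries of \<open>U\<close> enter \<open>rp\<close>,
      \<open>t\<close> and \<open>qp\<close>; those of \<open>U$1$1\<close> cancel, and the rest
      share the factor \<open>(h1 - h2) * (h1 - h3)\<close>.\<close>
    have "L * (rp - t * h1 + qp * (- h2 * h3 + h1 * h3 + h1 * h2))
         + M * (rp * (h2 + h3 - h1) - t * h2 * h3 + qp * h1 * h2 * h3)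
      = - ((h1 - h2) * (h1 - h3) * (U$2$2 * (L + M * h3) + U$3$3 * (L + M * h2)))"
      by (simp only: c) algebra
    moreover have "(L + M * h2) * (L + M * h3) + U$2$2 * (L + M * h3) + U$3$3 * (L + M * h2)
      = U$2$3 * U$3$2 - U$2$2 * U$3$3"
      unfolding comb using wz by algebra
    \<comment> \<open>The terms in \<open>qm\<close> and \<open>rm\<close> give the minors on rows
      1, 2 and 1, 3 with the right weights. The minor on rows 2, 3 falls short by
      \<open>(h1 - h2) * (h1 - h3)\<close> times itself, which the two identities above
      supply.\<close>
    ultimately show ?thesis by (simp only: c) algebra
  qed
  finally have "rm' = 1 / (h1 * h2 * h3) * ?R"
    using nz by (simp add: field_simps)
  moreover have "d1' = inverse d1 \<and> d2' = d2 \<and> pp' = pm / d1 \<and> pm' = pp / d1 \<and> qp' = qp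
      \<and> qm' = qm \<and> rp' = (qp * pp - t) / d1 \<and> t' = (qp * pm - rp) / d1"
    using nz by (simp add: c c' field_simps)
  ultimately show ?thesis
    using GL2Z_action_inverse_first LM' by blast
qed

end
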